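(* Let $M$ be a conformally compact manifold of dimension $n\ge3$, with associated conformal class $\boldsymbol{c}$ on $M$ and density $\sigma\in\Gamma(\mathcal{E}[1])$ with zero locus $\mathcal{Z}(\sigma)=\partial M$. Then any generalised geodesic of $(M,\boldsymbol{c},\sigma)$ which extends to the boundary $\partial M$ meets the boundary orthogonally; that is, if $\gamma$ is a (smooth) generalised geodesic and $\gamma(t_0)\in\partial M$, then the velocity of $\gamma$ at $t_0$ is orthogonal to $T_{\gamma(t_0)}\partial M$ with respect to $\boldsymbol{c}$.
   Context: Conformally compact: $M$ is a smooth connected $n$-manifold with boundary $\partial M$ and interior $\mathring M$, with a metric $\mathring g=r^{-2}g$ on $\mathring M$, where $g$ is a metric (of any signature) on all of $M$, nondegenerate up to $\partial M$, and $r$ is a defining function for $\partial M$: $\mathcal{Z}(r)=\partial M$ and $dr\ne0$ at all points of $\partial M$. The conformal class is $\boldsymbol{c}=[g]$ on $M$, and $\sigma=r\sigma_g$ where $g=\sigma_g^{-2}\mathbf{g}$, so $\mathring g=\sigma^{-2}\mathbf{g}$ on $\mathring M$. Conventions. Abstract indices are used: $\mathcal{E}^a=TM$, $\mathcal{E}_a=T^*M$. Density bundles: $\mathcal{E}[w]=\big((\Lambda^nTM)^{2}\big)^{w/2n}$ for $w\in\mathbb{R}$, $\mathcal{E}_+[1]$ is the bundle of positive 1-densities, and $\mathcal{V}[w]=\mathcal{V}\otimes\mathcal{E}[w]$. The conformal metric $\mathbf{g}_{ab}\in\Gamma(\mathcal{E}_{(ab)}[2])$ is characterised by: each $g\in\boldsymbol{c}$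 is $\sigma_g^{-2}\mathbf{g}$ for a unique $\sigma_g\in\Gamma(\mathcal{E}_+[1])$. Indices are raised and lowered with $\mathbf{g}$; the Levi-Civita connection $\nabla$ of $g\in\boldsymbol{c}$ acts on densities and preserves $\mathbf{g}$ and $\sigma_g$. $P_{ab}=\frac{1}{n-2}(\mathrm{Ric}_{ab}-J\mathbf{g}_{ab})$ is the Schouten tensor of $g$, $J=\mathbf{g}^{ab}P_{ab}$, $\Delta=\mathbf{g}^{ab}\nabla_a\nabla_b$. Tractors. The standard tractor bundle $\mathcal{T}$ is the rank $n+2$ bundle which, for each $g\in\boldsymbol{c}$, is identified with $\mathcal{E}[1]\oplus\mathcal{E}_a[1]\oplus\mathcal{E}[-1]$; for $\hat g=e^{2\omega}g$, $\Upsilon=d\omega$, the triples are related by $(\hat\sigma,\hat\mu_a,\hat\rho)=(\sigma,\ \mu_a+\Upsilon_a\sigma,\ \rho-\Upsilon^b\mu_b-\tfrac12\Upsilon^b\Upsilon_b\sigma)$. In a scale $g$ write $V^A=\sigma Y^A+\mu^aZ^A{}_a+\rho X^A$ for the triple $(\sigma,\mu_a,\rho)$; $X^A\in\Gamma(\mathcal{E}^A[1])$ is conformally invariant. The tractor connection is $\nabla_a(\sigma,\mu_b,\rho)=(\nabla_a\sigma-\mu_a,\ \nabla_a\mu_b+\mathbf{g}_{ab}\rho+P_{ab}\sigma,\ \nabla_a\rho-P_{ab}\mu^b)$. Scale tractor of $\sigma\in\Gamma(\mathcal{E}[1])$: $I=\big(\sigma,\ \nabla_a\sigma,\ -\tfrac1n(\Delta\sigma+J\sigma)\big)\in\Gamma(\mathcal{T})$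 (conformally invariant). Curves. A curve is a smooth regular map from an interval to $M$. For a nowhere-null curve with velocity $u^a$ put $\sigma_u=\sqrt{\pm\mathbf{g}_{ab}u^au^b}$ ($+$ if spacelike, $-$ if timelike), weighted velocity $\mathbf{u}^a=\sigma_u^{-1}u^a$ (so $\mathbf{u}^a\mathbf{u}_a=\pm1$), and, in a scale $g$, weighted acceleration $\mathbf{a}^b=\mathbf{u}^a\nabla_a\mathbf{u}^b$. With $U^A=\sigma_u\mathbf{u}^a\nabla_a(\sigma_u^{-1}X^A)$ and $A^B=\sigma_u\mathbf{u}^a\nabla_aU^B$, the 3-tractor of $\gamma$ is $$\Sigma^{ABC}=6\sigma_u^{-1}X^{[A}U^BA^{C]}=\pm6\,\mathbf{u}^cX^{[A}Y^BZ^{C]}{}_c+6\,\mathbf{u}^b\mathbf{a}^cX^{[A}Z^B{}_bZ^{C]}{}_c ,$$ which is conformally invariant and parametrisation independent. Generalised geodesic of $(M,\boldsymbol{c},\sigma)$: a (nowhere-null) unparametrised curve $\gamma$ in $M$ with $I\wedge\Sigma=0$ at all of its points, where $I\wedge\Sigma:=I^{[A}\Sigma^{BCD]}$. *)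

theory Defs
  imports "HOL-Analysis.Analysis" "HOL-Combinatorics.Permutations"
begin

subsection \<open>Smooth maps\<close>

text \<open>\<open>Ck_on\<close> is meant for open sets only; \<open>smooth_on\<close> is the usual notion for an arbitrary
  set (local smooth extendability), so it covers boundary points of half spaces and end points
  of intervals.\<close>

primrec Ck_on ::
  "nat \<Rightarrow> ('a::euclidean_space \<Rightarrow> 'b::real_normed_vector) \<Rightarrow> 'a set \<Rightarrow> bool" where
  "Ck_on 0 = (\<lambda>f U. continuous_on U f)"
| "Ck_on (Suc k) = (\<lambda>f U. f differentiable_on U \<and>
      (\<forall>v. Ck_on k (\<lambda>x. frechet_derivative f (at x) v) U))"

definition smooth_on ::
  "('a::euclidean_space \<Rightarrow> 'b::real_normed_vector) \<Rightarrow> 'a set \<Rightarrow> bool" where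
  "smooth_on f S \<longleftrightarrow>
     (\<forall>x\<in>S. \<exists>U F. open U \<and> x \<in> U \<and> (\<forall>k. Ck_on k F U) \<and> (\<forall>y\<in>S \<inter> U. F y = f y))"

subsection \<open>Manifolds with boundary\<close>

text \<open>The model space is a closed half space of \<open>\<real>\<^sup>n\<close>, \<open>n = CARD('n)\<close>; the coordinate that is
  required to be nonnegative is an arbitrary but fixed one.\<close>

definition normal_index :: "'n" where
  "normal_index = (SOME i. True)"

definition half_space :: "(real ^ 'n) set" where
  "half_space = {x. 0 \<le> x $ normal_index}"

type_synonym ('m, 'n) chart = "'m set \<times> ('m \<Rightarrow> real ^ 'n)"

abbreviation chart_dom :: "('m, 'n) chart \<Rightarrow> 'm set" where
  "chart_dom c \<equiv> fst c"

abbreviation coords :: "('m, 'n) chart \<Rightarrow> 'm \<Rightarrow> real ^ 'n" where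
  "coords c \<equiv> snd c"

definition chart_image :: "('m, 'n) chart \<Rightarrow> (real ^ 'n) set" where
  "chart_image c = coords c ` chart_dom c"

definition chart_inv :: "('m, 'n) chart \<Rightarrow> real ^ 'n \<Rightarrow> 'm" where
  "chart_inv c = inv_into (chart_dom c) (coords c)"

definition is_chart :: "'m topology \<Rightarrow> ('m, 'n::finite) chart \<Rightarrow> bool" where
  "is_chart M c \<longleftrightarrow>
     openin M (chart_dom c) \<and>
     openin (top_of_set half_space) (chart_image c) \<and>
     homeomorphic_map (subtopology M (chart_dom c)) (top_of_set (chart_image c)) (coords c)"

definition transition :: "('m, 'n) chart \<Rightarrow> ('m, 'n) chart \<Rightarrow> real ^ 'n \<Rightarrow> real ^ 'n" where
  "transition c c' = coords c' \<circ> chart_inv c"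

definition manifold_with_boundary :: "'m topology \<Rightarrow> ('m, 'n::finite) chart set \<Rightarrow> bool" where
  "manifold_with_boundary M \<A> \<longleftrightarrow>
     Hausdorff_space M \<and> second_countable M \<and>
     (\<forall>c\<in>\<A>. is_chart M c) \<and>
     (\<Union>c\<in>\<A>. chart_dom c) = topspace M \<and>
     (\<forall>c\<in>\<A>. \<forall>c'\<in>\<A>. smooth_on (transition c c') (coords c ` (chart_dom c \<inter> chart_dom c')))"

definition boundary :: "('m, 'n::finite) chart set \<Rightarrow> 'm set" where
  "boundary \<A> = {p. \<exists>c\<in>\<A>. p \<in> chart_dom c \<and> coords c p $ normal_index = 0}"

definition smooth_function :: "('m, 'n::finite) chart set \<Rightarrow> ('m \<Rightarrow> real) \<Rightarrow> bool" where
  "smooth_function \<A> f \<longleftrightarrow> (\<forall>c\<in>\<A>. smooth_on (f \<circ> chart_inv c) (chart_image c))"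

text \<open>Partial derivatives are taken within the chart image, hence one-sided at the boundary.\<close>

definition partial_deriv ::
  "(real ^ 'n) set \<Rightarrow> 'n::finite \<Rightarrow> (real ^ 'n \<Rightarrow> real) \<Rightarrow> real ^ 'n \<Rightarrow> real" where
  "partial_deriv S i f x = frechet_derivative f (at x within S) (axis i 1)"

definition jacobian_matrix ::
  "('m, 'n::finite) chart \<Rightarrow> ('m, 'n) chart \<Rightarrow> 'm \<Rightarrow> real ^ 'n ^ 'n" where
  "jacobian_matrix c c' p =
     matrix (frechet_derivative (transition c c')
       (at (coords c p) within coords c ` (chart_dom c \<inter> chart_dom c')))"

definition defining_function :: "'m topology \<Rightarrow> ('m, 'n::finite) chart set \<Rightarrow> ('m \<Rightarrow> real) \<Rightarrow> bool"
  where
  "defining_function M \<A> r \<longleftrightarrow>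
     smooth_function \<A> r \<and>
     {p \<in> topspace M. r p = 0} = boundary \<A> \<and>
     (\<forall>c\<in>\<A>. \<forall>p\<in>boundary \<A> \<inter> chart_dom c.
        \<exists>i. partial_deriv (chart_image c) i (r \<circ> chart_inv c) (coords c p) \<noteq> 0)"

subsection \<open>Metrics and conformal classes\<close>

text \<open>Tensor fields and densities are given by their component functions in each chart of the
  atlas, as functions of the coordinates.\<close>

type_synonym ('m, 'n) sym2_field = "('m, 'n) chart \<Rightarrow> real ^ 'n \<Rightarrow> real ^ 'n ^ 'n"
type_synonym ('m, 'n) density_field = "('m, 'n) chart \<Rightarrow> real ^ 'n \<Rightarrow> real"

definition metric_on :: "('m, 'n::finite) chart set \<Rightarrow> 'm set \<Rightarrow> ('m, 'n) sym2_field \<Rightarrow> bool" where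
  "metric_on \<A> D g \<longleftrightarrow>
     (\<forall>c\<in>\<A>. smooth_on (g c) (coords c ` (chart_dom c \<inter> D))) \<and>
     (\<forall>c\<in>\<A>. \<forall>p\<in>chart_dom c \<inter> D.
        transpose (g c (coords c p)) = g c (coords c p) \<and> det (g c (coords c p)) \<noteq> 0) \<and>
     (\<forall>c\<in>\<A>. \<forall>c'\<in>\<A>. \<forall>p\<in>chart_dom c \<inter> chart_dom c' \<inter> D.
        g c (coords c p) =
          transpose (jacobian_matrix c c' p) ** g c' (coords c' p) ** jacobian_matrix c c' p)"

definition conformally_compact ::
  "'m topology \<Rightarrow> ('m, 'n::finite) chart set \<Rightarrow>
   ('m, 'n) sym2_field \<Rightarrow> ('m, 'n) sym2_field \<Rightarrow> ('m \<Rightarrow> real) \<Rightarrow> bool" where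
  "conformally_compact M \<A> g\<^sub>0 g r \<longleftrightarrow>
     manifold_with_boundary M \<A> \<and> connected_space M \<and>
     metric_on \<A> (topspace M) g \<and>
     metric_on \<A> (topspace M - boundary \<A>) g\<^sub>0 \<and>
     defining_function M \<A> r \<and>
     (\<forall>c\<in>\<A>. \<forall>p\<in>chart_dom c - boundary \<A>.
        g\<^sub>0 c (coords c p) = (1 / (r p)\<^sup>2) *\<^sub>R g c (coords c p))"

definition conformal_class ::
  "'m topology \<Rightarrow> ('m, 'n::finite) chart set \<Rightarrow> ('m, 'n) sym2_field \<Rightarrow> ('m, 'n) sym2_field set" where
  "conformal_class M \<A> g =
     {h. metric_on \<A> (topspace M) h \<and>
         (\<exists>\<omega>. smooth_function \<A> \<omega> \<and>
           (\<forall>c\<in>\<A>. \<forall>p\<in>chart_dom c. h c (coords c p) = exp (2 * \<omega> p) *\<^sub>R g c (coords c p)))}"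

subsection \<open>Densities and the conformal metric\<close>

text \<open>A section of \<open>\<E>[w]\<close> is represented in a chart by its component relative to the frame
  \<open>((\<partial>\<^sub>1 \<and> \<dots> \<and> \<partial>\<^sub>n)\<^sup>2)\<close> to the power \<open>w/2n\<close> of \<open>\<E>[w]\<close>, and similarly for weighted tensors. For a
  metric with component matrix \<open>G\<close>, the canonical section of \<open>(\<Lambda>\<^sup>n TM)\<^sup>2\<close> is \<open>|det G|\<close> to the
  power \<open>-1\<close> times the frame, so the positive density of weight one has component \<open>|det G|\<close> to
  the power \<open>-1/2n\<close>, and the components of the conformal metric are the same for all metrics in
  the class.\<close>

definition metric_density :: "real ^ 'n ^ 'n \<Rightarrow> real" where
  "metric_density G = \<bar>det G\<bar> powr (- 1 / (2 * real CARD('n)))"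

definition conformal_metric :: "real ^ 'n ^ 'n \<Rightarrow> real ^ 'n ^ 'n" where
  "conformal_metric G = (metric_density G)\<^sup>2 *\<^sub>R G"

definition defining_density ::
  "('m, 'n::finite) sym2_field \<Rightarrow> ('m \<Rightarrow> real) \<Rightarrow> ('m, 'n) density_field" where
  "defining_density g r = (\<lambda>c x. r (chart_inv c x) * metric_density (g c x))"

lemma det_scaleR: "det (k *\<^sub>R G) = k ^ CARD('n) * det (G :: real ^ 'n ^ 'n)"
proof -
  have "k *\<^sub>R G = (\<chi> i. k *s G $ i)"
    by (simp add: vec_eq_iff)
  then show ?thesis
    using det_rows_mul[of "\<lambda>_. k" "\<lambda>i. G $ i"] by simp
qed

lemma conformal_metric_scaleR:
  assumes "k > 0"
  shows "conformal_metric (k *\<^sub>R G) = conformal_metric (G :: real ^ 'n ^ 'n)"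
proof -
  let ?n = "real CARD('n)"
  have "metric_density (k *\<^sub>R G) = (k powr ?n) powr (- 1 / (2 * ?n)) * metric_density G"
    using assms by (simp add: metric_density_def det_scaleR abs_mult powr_mult powr_realpow)
  also have "(k powr ?n) powr (- 1 / (2 * ?n)) = k powr (- 1 / 2)"
    by (simp add: powr_powr)
  finally have "(metric_density (k *\<^sub>R G))\<^sup>2 * k = (k powr (- 1 / 2))\<^sup>2 * k * (metric_density G)\<^sup>2"
    by (simp add: power_mult_distrib)
  also have "(k powr (- 1 / 2))\<^sup>2 * k = 1"
    using assms by (simp add: power2_eq_square flip: powr_add)
  finally show ?thesis
    by (simp add: conformal_metric_def)
qed

subsection \<open>The Levi-Civita connection and the Schouten tensor\<close>

text \<open>In this and the next two sections, \<open>S\<close> is the image of a chart and \<open>G\<close> gives the components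
  in that chart of the scale, i.e. of the chosen metric in the conformal class.\<close>

definition christoffel ::
  "(real ^ 'n) set \<Rightarrow> (real ^ 'n \<Rightarrow> real ^ 'n ^ 'n) \<Rightarrow> 'n::finite \<Rightarrow> 'n \<Rightarrow> 'n \<Rightarrow> real ^ 'n \<Rightarrow> real" where
  "christoffel S G k i j x =
     (\<Sum>l\<in>UNIV. matrix_inv (G x) $ k $ l *
        (partial_deriv S i (\<lambda>y. G y $ j $ l) x + partial_deriv S j (\<lambda>y. G y $ i $ l) x
         - partial_deriv S l (\<lambda>y. G y $ i $ j) x)) / 2"

text \<open>The connection form of \<open>\<E>[1]\<close> in the frame above: that of \<open>(\<Lambda>\<^sup>n TM)\<^sup>2\<close> divided by \<open>2n\<close>.\<close>

definition density_connection ::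
  "(real ^ 'n) set \<Rightarrow> (real ^ 'n \<Rightarrow> real ^ 'n ^ 'n) \<Rightarrow> 'n::finite \<Rightarrow> real ^ 'n \<Rightarrow> real" where
  "density_connection S G i x = (\<Sum>k\<in>UNIV. christoffel S G k i k x) / real CARD('n)"

definition nabla_density ::
  "(real ^ 'n) set \<Rightarrow> (real ^ 'n \<Rightarrow> real ^ 'n ^ 'n) \<Rightarrow> real \<Rightarrow> (real ^ 'n \<Rightarrow> real) \<Rightarrow>
   real ^ 'n \<Rightarrow> real ^ 'n::finite" where
  "nabla_density S G w s x =
     (\<chi> i. partial_deriv S i s x + w * density_connection S G i x * s x)"

text \<open>Row index: the direction of differentiation.\<close>

definition nabla_covector ::
  "(real ^ 'n) set \<Rightarrow> (real ^ 'n \<Rightarrow> real ^ 'n ^ 'n) \<Rightarrow> real \<Rightarrow> (real ^ 'n \<Rightarrow> real ^ 'n) \<Rightarrow>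
   real ^ 'n \<Rightarrow> real ^ 'n ^ 'n::finite" where
  "nabla_covector S G w \<mu> x =
     (\<chi> i j. partial_deriv S i (\<lambda>y. \<mu> y $ j) x - (\<Sum>k\<in>UNIV. christoffel S G k i j x * \<mu> x $ k)
        + w * density_connection S G i x * \<mu> x $ j)"

definition ricci ::
  "(real ^ 'n) set \<Rightarrow> (real ^ 'n \<Rightarrow> real ^ 'n ^ 'n) \<Rightarrow> real ^ 'n \<Rightarrow> real ^ 'n ^ 'n::finite" where
  "ricci S G x =
     (\<chi> i j. \<Sum>k\<in>UNIV. partial_deriv S k (christoffel S G k i j) x
        - partial_deriv S j (christoffel S G k i k) x
        + (\<Sum>l\<in>UNIV. christoffel S G k k l x * christoffel S G l i j x
             - christoffel S G k j l x * christoffel S G l i k x))"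

definition conf_trace :: "real ^ 'n ^ 'n \<Rightarrow> real ^ 'n ^ 'n \<Rightarrow> real" where
  "conf_trace G T = (\<Sum>i\<in>UNIV. \<Sum>j\<in>UNIV. matrix_inv (conformal_metric G) $ i $ j * T $ i $ j)"

text \<open>Taking the trace of \<open>(n - 2) P = Ric - J \<^bold>g\<close> determines \<open>J\<close>; see \<open>schouten_trace_eq\<close>.\<close>

definition schouten_trace ::
  "(real ^ 'n) set \<Rightarrow> (real ^ 'n \<Rightarrow> real ^ 'n ^ 'n) \<Rightarrow> real ^ 'n::finite \<Rightarrow> real" where
  "schouten_trace S G x = conf_trace (G x) (ricci S G x) / (2 * (real CARD('n) - 1))"

definition schouten ::
  "(real ^ 'n) set \<Rightarrow> (real ^ 'n \<Rightarrow> real ^ 'n ^ 'n) \<Rightarrow> real ^ 'n \<Rightarrow> real ^ 'n ^ 'n::finite" where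
  "schouten S G x =
     (1 / (real CARD('n) - 2)) *\<^sub>R
       (ricci S G x - schouten_trace S G x *\<^sub>R conformal_metric (G x))"

lemma conf_trace_conformal_metric:
  fixes G :: "real ^ 'n ^ 'n"
  assumes "det G \<noteq> 0" "transpose G = G"
  shows "conf_trace G (conformal_metric G) = real CARD('n)"
proof -
  let ?C = "conformal_metric G"
  have "metric_density G \<noteq> 0"
    using assms(1) by (simp add: metric_density_def)
  then have "det ?C \<noteq> 0"
    using assms(1) by (simp add: conformal_metric_def det_scaleR)
  then have "\<exists>B. ?C ** B = mat 1 \<and> B ** ?C = mat 1"
    by (simp add: invertible_det_nz flip: invertible_def)
  from someI_ex[OF this] have inv: "matrix_inv ?C ** ?C = mat 1"
    by (simp add: matrix_inv_def)
  have sym: "?C $ i $ j = ?C $ j $ i" for i j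
    using arg_cong[OF assms(2), of "\<lambda>A. A $ i $ j"] by (simp add: conformal_metric_def transpose_def)
  have "conf_trace G ?C = (\<Sum>i\<in>UNIV. (matrix_inv ?C ** ?C) $ i $ i)"
    unfolding conf_trace_def matrix_matrix_mult_def using sym by simp
  also have "\<dots> = real CARD('n)"
    by (simp add: inv mat_def)
  finally show ?thesis .
qed

lemma schouten_trace_eq:
  fixes G :: "real ^ 'n \<Rightarrow> real ^ 'n ^ 'n"
  assumes "det (G x) \<noteq> 0" "transpose (G x) = G x" "CARD('n) \<ge> 3"
  shows "conf_trace (G x) (schouten S G x) = schouten_trace S G x"
proof -
  let ?n = "real CARD('n)" and ?J = "schouten_trace S G x" and ?R = "conf_trace (G x) (ricci S G x)"
  have "conf_trace (G x) (schouten S G x)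
      = (?R - ?J * conf_trace (G x) (conformal_metric (G x))) / (?n - 2)"
    by (simp add: conf_trace_def schouten_def sum_subtractf sum_distrib_left sum_divide_distrib
        algebra_simps diff_divide_distrib)
  also have "\<dots> = (?R - ?J * ?n) / (?n - 2)"
    using assms by (simp add: conf_trace_conformal_metric)
  also have "?R = ?J * (2 * (?n - 1))"
    using assms(3) by (simp add: schouten_trace_def)
  also have "(?J * (2 * (?n - 1)) - ?J * ?n) / (?n - 2) = ?J * (?n - 2) / (?n - 2)"
    by (simp add: algebra_simps)
  finally show ?thesis
    using assms(3) by simp
qed

subsection \<open>Tractors in a scale\<close>

text \<open>A tractor, in a scale and a chart, is a triple \<open>(\<sigma>, \<mu>\<^sub>a, \<rho>)\<close>. Its components are taken
  relative to the frame \<open>Y, Z\<^sup>a, X\<close> with \<open>Z\<^sup>a = \<^bold>g\<^sup>a\<^sup>b Z\<^sub>b\<close>, so that \<open>\<mu>\<close> contributes its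
  covariant components.\<close>

type_synonym 'n tractor = "real \<times> (real ^ 'n) \<times> real"

datatype 'n tractor_index = IY | IZ 'n | IX

fun tractor_comp :: "'n::finite tractor \<Rightarrow> 'n tractor_index \<Rightarrow> real" where
  "tractor_comp (\<sigma>, \<mu>, \<rho>) IY = \<sigma>"
| "tractor_comp (\<sigma>, \<mu>, \<rho>) (IZ a) = \<mu> $ a"
| "tractor_comp (\<sigma>, \<mu>, \<rho>) IX = \<rho>"

definition tractor_X :: "'n::finite tractor" where
  "tractor_X = (0, 0, 1)"

definition scale_tractor ::
  "(real ^ 'n) set \<Rightarrow> (real ^ 'n \<Rightarrow> real ^ 'n ^ 'n) \<Rightarrow> (real ^ 'n \<Rightarrow> real) \<Rightarrow>
   real ^ 'n::finite \<Rightarrow> 'n tractor" where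
  "scale_tractor S G \<sigma> x =
     (\<sigma> x,
      nabla_density S G 1 \<sigma> x,
      - (conf_trace (G x) (nabla_covector S G 1 (nabla_density S G 1 \<sigma>) x)
           + schouten_trace S G x * \<sigma> x) / real CARD('n))"

text \<open>A tensor with \<open>k\<close> tractor indices is a function of an index assignment \<open>nat \<Rightarrow> _\<close> that
  depends on the values at \<open>0, \<dots>, k - 1\<close> only.\<close>

definition alternation :: "nat \<Rightarrow> ((nat \<Rightarrow> 'i) \<Rightarrow> real) \<Rightarrow> (nat \<Rightarrow> 'i) \<Rightarrow> real" where
  "alternation k T = (\<lambda>ix. (\<Sum>p | p permutes {..<k}. of_int (sign p) * T (ix \<circ> p)) / fact k)"

subsection \<open>Tractors along curves\<close>

text \<open>Here \<open>x\<close> is the coordinate expression of a curve with parameter set \<open>K\<close>. The operators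
  below are covariant derivatives along its velocity \<open>u\<^sup>a\<close>, acting on densities and covectors of
  weight \<open>w\<close>, and on tractors of weight \<open>0\<close>.\<close>

definition velocity :: "real set \<Rightarrow> (real \<Rightarrow> real ^ 'n) \<Rightarrow> real \<Rightarrow> real ^ 'n::finite" where
  "velocity K x t = vector_derivative x (at t within K)"

definition density_deriv_along ::
  "(real ^ 'n) set \<Rightarrow> (real ^ 'n \<Rightarrow> real ^ 'n ^ 'n) \<Rightarrow> real set \<Rightarrow> (real \<Rightarrow> real ^ 'n::finite) \<Rightarrow>
   real \<Rightarrow> (real \<Rightarrow> real) \<Rightarrow> real \<Rightarrow> real" where
  "density_deriv_along S G K x w s t =
     vector_derivative s (at t within K)
       + w * (\<Sum>i\<in>UNIV. velocity K x t $ i * density_connection S G i (x t)) * s t"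

definition covector_deriv_along ::
  "(real ^ 'n) set \<Rightarrow> (real ^ 'n \<Rightarrow> real ^ 'n ^ 'n) \<Rightarrow> real set \<Rightarrow> (real \<Rightarrow> real ^ 'n::finite) \<Rightarrow>
   real \<Rightarrow> (real \<Rightarrow> real ^ 'n) \<Rightarrow> real \<Rightarrow> real ^ 'n" where
  "covector_deriv_along S G K x w \<mu> t =
     (\<chi> j. vector_derivative (\<lambda>t. \<mu> t $ j) (at t within K)
        - (\<Sum>i\<in>UNIV. \<Sum>k\<in>UNIV. velocity K x t $ i * christoffel S G k i j (x t) * \<mu> t $ k)
        + w * (\<Sum>i\<in>UNIV. velocity K x t $ i * density_connection S G i (x t)) * \<mu> t $ j)"

definition tractor_deriv_along ::
  "(real ^ 'n) set \<Rightarrow> (real ^ 'n \<Rightarrow> real ^ 'n ^ 'n) \<Rightarrow> real set \<Rightarrow> (real \<Rightarrow> real ^ 'n::finite) \<Rightarrow>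
   (real \<Rightarrow> 'n tractor) \<Rightarrow> real \<Rightarrow> 'n tractor" where
  "tractor_deriv_along S G K x V t =
     (let u = velocity K x t;
          C = conformal_metric (G (x t));
          P = schouten S G (x t);
          \<sigma> = (\<lambda>t. fst (V t)); \<mu> = (\<lambda>t. fst (snd (V t))); \<rho> = (\<lambda>t. snd (snd (V t)))
      in (density_deriv_along S G K x 1 \<sigma> t - u \<bullet> \<mu> t,
          covector_deriv_along S G K x 1 \<mu> t + \<rho> t *\<^sub>R (u v* C) + \<sigma> t *\<^sub>R (u v* P),
          density_deriv_along S G K x (- 1) \<rho> t - (u v* P) \<bullet> (matrix_inv C *v \<mu> t)))"

text \<open>\<open>speed_density\<close> is the density \<open>\<sigma>\<^sub>u\<close> of weight one; the absolute value accounts for both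
  the spacelike and the timelike case.\<close>

definition speed_density ::
  "(real ^ 'n \<Rightarrow> real ^ 'n ^ 'n) \<Rightarrow> real set \<Rightarrow> (real \<Rightarrow> real ^ 'n::finite) \<Rightarrow> real \<Rightarrow> real" where
  "speed_density G K x t =
     sqrt \<bar>velocity K x t \<bullet> (conformal_metric (G (x t)) *v velocity K x t)\<bar>"

text \<open>Since \<open>\<sigma>\<^sub>u \<^bold>u\<^sup>a = u\<^sup>a\<close>, the operator \<open>\<sigma>\<^sub>u \<^bold>u\<^sup>a \<nabla>\<^sub>a\<close> is the derivative along the velocity.
  Division by \<open>\<sigma>\<^sub>u\<close> makes \<open>X\<close>, of weight one, a tractor of weight zero.\<close>

definition velocity_tractor ::
  "(real ^ 'n) set \<Rightarrow> (real ^ 'n \<Rightarrow> real ^ 'n ^ 'n) \<Rightarrow> real set \<Rightarrow> (real \<Rightarrow> real ^ 'n::finite) \<Rightarrow>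
   real \<Rightarrow> 'n tractor" where
  "velocity_tractor S G K x =
     tractor_deriv_along S G K x (\<lambda>t. inverse (speed_density G K x t) *\<^sub>R tractor_X)"

definition acceleration_tractor ::
  "(real ^ 'n) set \<Rightarrow> (real ^ 'n \<Rightarrow> real ^ 'n ^ 'n) \<Rightarrow> real set \<Rightarrow> (real \<Rightarrow> real ^ 'n::finite) \<Rightarrow>
   real \<Rightarrow> 'n tractor" where
  "acceleration_tractor S G K x = tractor_deriv_along S G K x (velocity_tractor S G K x)"

definition three_tractor ::
  "(real ^ 'n) set \<Rightarrow> (real ^ 'n \<Rightarrow> real ^ 'n ^ 'n) \<Rightarrow> real set \<Rightarrow> (real \<Rightarrow> real ^ 'n::finite) \<Rightarrow>
   real \<Rightarrow> (nat \<Rightarrow> 'n tractor_index) \<Rightarrow> real" where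
  "three_tractor S G K x t = (\<lambda>ix.
     6 * inverse (speed_density G K x t) *
       alternation 3 (\<lambda>ix. tractor_comp tractor_X (ix 0)
         * tractor_comp (velocity_tractor S G K x t) (ix 1)
         * tractor_comp (acceleration_tractor S G K x t) (ix 2)) ix)"

definition scale_wedge_three_tractor ::
  "(real ^ 'n) set \<Rightarrow> (real ^ 'n \<Rightarrow> real ^ 'n ^ 'n) \<Rightarrow> (real ^ 'n \<Rightarrow> real) \<Rightarrow> real set \<Rightarrow>
   (real \<Rightarrow> real ^ 'n::finite) \<Rightarrow> real \<Rightarrow> (nat \<Rightarrow> 'n tractor_index) \<Rightarrow> real" where
  "scale_wedge_three_tractor S G \<sigma> K x t =
     alternation 4 (\<lambda>ix. tractor_comp (scale_tractor S G \<sigma> (x t)) (ix 0)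
       * three_tractor S G K x t (\<lambda>k. ix (Suc k)))"

subsection \<open>Generalised geodesics\<close>

definition chart_params :: "('m, 'n) chart \<Rightarrow> real set \<Rightarrow> (real \<Rightarrow> 'm) \<Rightarrow> real set" where
  "chart_params c T \<gamma> = {t \<in> T. \<gamma> t \<in> chart_dom c}"

definition chart_velocity ::
  "('m, 'n::finite) chart \<Rightarrow> real set \<Rightarrow> (real \<Rightarrow> 'm) \<Rightarrow> real \<Rightarrow> real ^ 'n" where
  "chart_velocity c T \<gamma> = velocity (chart_params c T \<gamma>) (coords c \<circ> \<gamma>)"

definition regular_curve ::
  "'m topology \<Rightarrow> ('m, 'n::finite) chart set \<Rightarrow> real set \<Rightarrow> (real \<Rightarrow> 'm) \<Rightarrow> bool" where
  "regular_curve M \<A> T \<gamma> \<longleftrightarrow>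
     is_interval T \<and> interior T \<noteq> {} \<and>
     continuous_map (top_of_set T) M \<gamma> \<and>
     (\<forall>c\<in>\<A>. smooth_on (coords c \<circ> \<gamma>) (chart_params c T \<gamma>) \<and>
        (\<forall>t\<in>chart_params c T \<gamma>. chart_velocity c T \<gamma> t \<noteq> 0))"

definition nowhere_null ::
  "('m, 'n::finite) chart set \<Rightarrow> ('m, 'n) sym2_field \<Rightarrow> real set \<Rightarrow> (real \<Rightarrow> 'm) \<Rightarrow> bool" where
  "nowhere_null \<A> h T \<gamma> \<longleftrightarrow>
     (\<forall>c\<in>\<A>. \<forall>t\<in>chart_params c T \<gamma>.
        chart_velocity c T \<gamma> t \<bullet> (h c (coords c (\<gamma> t)) *v chart_velocity c T \<gamma> t) \<noteq> 0)"

text \<open>The scale \<open>h\<close> is only used to express the tractors as triples: whether the conditions hold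
  does not depend on it, as they are conformally invariant.\<close>

definition generalised_geodesic ::
  "'m topology \<Rightarrow> ('m, 'n::finite) chart set \<Rightarrow> ('m, 'n) sym2_field set \<Rightarrow>
   ('m, 'n) density_field \<Rightarrow> real set \<Rightarrow> (real \<Rightarrow> 'm) \<Rightarrow> bool" where
  "generalised_geodesic M \<A> \<C> \<sigma> T \<gamma> \<longleftrightarrow>
     regular_curve M \<A> T \<gamma> \<and>
     (\<exists>h\<in>\<C>. nowhere_null \<A> h T \<gamma> \<and>
        (\<forall>c\<in>\<A>. \<forall>t\<in>chart_params c T \<gamma>. \<forall>ix.
           scale_wedge_three_tractor (chart_image c) (h c) (\<sigma> c)
             (chart_params c T \<gamma>) (coords c \<circ> \<gamma>) t ix = 0))"

text \<open>At a boundary point, the tangent space of the boundary consists of the vectors whose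
  component in the normal direction of the half space vanishes.\<close>

definition orthogonal_to_boundary ::
  "('m, 'n::finite) chart set \<Rightarrow> ('m, 'n) sym2_field set \<Rightarrow> real set \<Rightarrow> (real \<Rightarrow> 'm) \<Rightarrow> real \<Rightarrow> bool"
  where
  "orthogonal_to_boundary \<A> \<C> T \<gamma> t \<longleftrightarrow>
     (\<forall>h\<in>\<C>. \<forall>c\<in>\<A>. \<gamma> t \<in> chart_dom c \<longrightarrow>
        (\<forall>v. v $ normal_index = 0 \<longrightarrow>
           chart_velocity c T \<gamma> t \<bullet> (h c (coords c (\<gamma> t)) *v v) = 0))"

end

(* Only the boundary point itself matters. There sigma = r sigma_g vanishes and d sigma = sigma_g dr
   is a nonzero conormal of the boundary, while I, X, U, A have Y components 0, 0, 0 and a nonzero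
   number. Hence the vanishing of I wedge X wedge U wedge A forces the middle slot d sigma of I to be
   proportional to the middle slot of U, which is the velocity with its index lowered. *)

theory Submission
  imports Defs
begin

section \<open>Alternation of tensors\<close>

lemma alternation_0 [simp]: "alternation 0 T ix = T ix"
  by (simp add: alternation_def sign_id)

text \<open>Every permutation of \<open>k + 1\<close> slots is uniquely a permutation of the first
  \<open>k\<close> followed by the transposition of \<open>k\<close> with some \<open>b\<close>; the
  sign flips unless \<open>b = k\<close>. The recursion lets a concrete alternation be expanded by
  rewriting.\<close>

lemma alternation_Suc:
  "alternation (Suc k) T ix =
     (alternation k T ix - (\<Sum>b<k. alternation k T (ix \<circ> Transposition.transpose k b))) / real (Suc k)"
proof -
  let ?P = "{p. p permutes {..<k}}"
  have "(\<Sum>p | p permutes {..<Suc k}. of_int (sign p) * T (ix \<circ> p))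
      = (\<Sum>b<Suc k. \<Sum>p\<in>?P. of_int (sign (Transposition.transpose k b \<circ> p))
            * T (ix \<circ> (Transposition.transpose k b \<circ> p)))"
    unfolding lessThan_Suc by (rule sum_over_permutations_insert) auto
  also have "\<dots> = (\<Sum>b<Suc k. (if b = k then 1 else - 1)
      * (\<Sum>p\<in>?P. of_int (sign p) * T (ix \<circ> Transposition.transpose k b \<circ> p)))"
    unfolding sum_distrib_left
  proof (intro sum.cong refl)
    fix b p
    assume "p \<in> ?P"
    then have "permutation p"
      using permutation_permutes by blast
    then have "sign (Transposition.transpose k b \<circ> p) = (if b = k then 1 else - 1) * sign p"
      by (simp add: sign_compose permutation_swap_id sign_swap_id)
    then show "of_int (sign (Transposition.transpose k b \<circ> p)) * T (ix \<circ> (Transposition.transpose k b \<circ> p))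
        = (if b = k then 1 else - 1) * (of_int (sign p) * T (ix \<circ> Transposition.transpose k b \<circ> p))"
      by (simp add: comp_assoc)
  qed
  finally show ?thesis
    by (simp add: alternation_def sum_negf field_simps flip: sum_divide_distrib)
qed

text \<open>The factors model I, X, U and A, and the indices the slots Y, Z_a, Z_b and X. At
  \<open>i\<^sub>0\<close> only \<open>\<delta>\<close> can survive, and of the four indices
  \<open>\<beta>\<close> survives only at \<open>i\<^sub>3\<close>, so antisymmetry leaves a 2 by 2
  minor of \<open>\<alpha>\<close> and \<open>\<gamma>\<close>.\<close>

lemma alternation_wedge_vanishing:
  fixes \<alpha> \<beta> \<gamma> \<delta> :: "'i \<Rightarrow> real"
  assumes "\<alpha> i\<^sub>0 = 0" "\<beta> i\<^sub>0 = 0" "\<beta> i\<^sub>1 = 0" "\<beta> i\<^sub>2 = 0" "\<gamma> i\<^sub>0 = 0"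
    and "\<And>ix. alternation 4 (\<lambda>ix. \<alpha> (ix 0) *
      (w * alternation 3 (\<lambda>ix. \<beta> (ix 0) * \<gamma> (ix 1) * \<delta> (ix 2)) (\<lambda>k. ix (Suc k)))) ix = 0"
  shows "w * \<beta> i\<^sub>3 * \<delta> i\<^sub>0 * (\<alpha> i\<^sub>1 * \<gamma> i\<^sub>2 - \<alpha> i\<^sub>2 * \<gamma> i\<^sub>1) = 0"
proof -
  define ix where "ix = (\<lambda>k::nat. if k = 0 then i\<^sub>0 else if k = 1 then i\<^sub>1 else if k = 2 then i\<^sub>2 else i\<^sub>3)"
  have ix: "ix 0 = i\<^sub>0" "ix (Suc 0) = i\<^sub>1" "ix (Suc (Suc 0)) = i\<^sub>2" "ix (Suc (Suc (Suc 0))) = i\<^sub>3"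
    by (simp_all add: ix_def)
  \<comment> \<open>The nested alternations amount to a single one over 4! = 24 permutations, of
    which two survive, with opposite signs.\<close>
  have "alternation 4 (\<lambda>ix. \<alpha> (ix 0) *
      (w * alternation 3 (\<lambda>ix. \<beta> (ix 0) * \<gamma> (ix 1) * \<delta> (ix 2)) (\<lambda>k. ix (Suc k)))) ix
    = w * \<beta> i\<^sub>3 * \<delta> i\<^sub>0 * (\<alpha> i\<^sub>1 * \<gamma> i\<^sub>2 - \<alpha> i\<^sub>2 * \<gamma> i\<^sub>1) / 24"
    by (simp add: assms(1-5) numeral_eq_Suc alternation_Suc ix Transposition.transpose_def)
      (simp add: field_simps)
  with assms(6)[of ix] show ?thesis
    by simp
qed

section \<open>One-sided derivatives on half spaces\<close>

text \<open>At a zero of \<open>f\<close> the product rule loses its term with the derivative of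
  \<open>m\<close>, so continuity of \<open>m\<close> is enough. This differentiates the density r
  sigma_g on the boundary without differentiating the determinant power in sigma_g.\<close>

lemma has_derivative_mult_vanishing:
  fixes f m :: "'a::real_normed_vector \<Rightarrow> real"
  assumes f: "(f has_derivative f') (at x within S)" and "f x = 0"
    and m: "continuous (at x within S) m"
  shows "((\<lambda>y. f y * m y) has_derivative (\<lambda>v. f' v * m x)) (at x within S)"
proof -
  have bl: "bounded_linear f'"
    using f by (rule has_derivative_bounded_linear)
  then obtain K where K: "\<And>v. norm (f' v) \<le> norm v * K"
    using bounded_linear.bounded by blast
  have m0: "((\<lambda>y. \<bar>m y - m x\<bar>) \<longlongrightarrow> 0) (at x within S)"
    using m by (simp add: continuous_within LIM_zero tendsto_rabs_zero)
  have f0: "((\<lambda>y. (f y - f' (y - x)) / norm (y - x)) \<longlongrightarrow> 0) (at x within S)"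
    using f \<open>f x = 0\<close> by (simp add: has_derivative_within divide_inverse mult.commute)
  \<comment> \<open>The remainder of the product is
    \<open>(f y - f' (y - x)) * m y + (m y - m x) * f' (y - x)\<close>. This is its second summand
    over the distance, controlled by the operator bound \<open>K\<close>.\<close>
  have "((\<lambda>y. (m y - m x) * (f' (y - x) / norm (y - x))) \<longlongrightarrow> 0) (at x within S)"
  proof (rule Lim_null_comparison)
    show "\<forall>\<^sub>F y in at x within S.
        norm ((m y - m x) * (f' (y - x) / norm (y - x))) \<le> \<bar>m y - m x\<bar> * K"
    proof (intro always_eventually allI)
      fix y
      have "norm (f' (y - x)) / norm (y - x) \<le> K" if "y \<noteq> x"
        using K[of "y - x"] that by (simp add: divide_le_eq mult.commute)
      moreover have "f' 0 = 0"
        using bl by (rule linear_simps)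
      ultimately show "norm ((m y - m x) * (f' (y - x) / norm (y - x))) \<le> \<bar>m y - m x\<bar> * K"
        by (cases "y = x") (auto simp: abs_mult simp flip: times_divide_eq_right intro!: mult_left_mono)
    qed
    show "((\<lambda>y. \<bar>m y - m x\<bar> * K) \<longlongrightarrow> 0) (at x within S)"
      using tendsto_mult_right[OF m0, of K] by simp
  qed
  from tendsto_add[OF tendsto_mult[OF f0 m[unfolded continuous_within]] this]
  have "((\<lambda>y. (f y * m y - f' (y - x) * m x) / norm (y - x)) \<longlongrightarrow> 0) (at x within S)"
    by (simp add: divide_inverse algebra_simps)
  then show ?thesis
    using \<open>f x = 0\<close> bounded_linear_compose[OF bounded_linear_mult_left bl, of "m x"]
    by (simp add: has_derivative_within divide_inverse mult.commute)
qed

lemma smooth_on_has_derivative: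
  assumes "smooth_on f S" "x \<in> S"
  obtains f' where "(f has_derivative f') (at x within S)"
proof -
  from assms obtain U F where U: "open U" "x \<in> U" "Ck_on (Suc 0) F U" "\<forall>y\<in>S \<inter> U. F y = f y"
    unfolding smooth_on_def by blast
  then have "F differentiable_on U"
    by simp
  with U(1,2) obtain F' where "(F has_derivative F') (at x)"
    by (metis at_within_open differentiable_def differentiable_on_def)
  then have F: "(F has_derivative F') (at x within S)"
    by (rule has_derivative_at_withinI)
  from U obtain e where "e > 0" "ball x e \<subseteq> U"
    using open_contains_ball by blast
  with U have "(f has_derivative F') (at x within S)"
    by (intro has_derivative_transform_within[OF F \<open>e > 0\<close> \<open>x \<in> S\<close>]) (auto simp: dist_commute subset_iff)
  then show thesis ..
qed

lemma smooth_on_imp_continuous_on: "smooth_on f S \<Longrightarrow> continuous_on S f"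
  unfolding continuous_on_eq_continuous_within
  by (blast elim: smooth_on_has_derivative intro: has_derivative_continuous)

lemma half_space_basis_step:
  fixes S :: "(real ^ 'n::finite) set"
  assumes "openin (top_of_set half_space) S" "x \<in> S" "e > 0"
  shows "\<exists>d. 0 < \<bar>d\<bar> \<and> \<bar>d\<bar> < e \<and> x + d *\<^sub>R axis i 1 \<in> S"
proof -
  from assms obtain \<delta> where \<delta>: "\<delta> > 0" "\<And>y. y \<in> half_space \<Longrightarrow> dist y x < \<delta> \<Longrightarrow> y \<in> S"
    by (auto simp: openin_euclidean_subtopology_iff)
  have "x \<in> half_space"
    using assms openin_imp_subset by blast
  define d where "d = min \<delta> e / 2"
  have "d > 0" "d < \<delta>" "d < e"
    using assms \<delta> by (auto simp: d_def)
  then show ?thesis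
    using \<open>x \<in> half_space\<close>
    by (intro exI[of _ d] conjI \<delta>) (simp_all add: half_space_def dist_norm, simp add: axis_def)
qed

text \<open>\<open>frechet_derivative\<close> is a choice, pinned down only where derivatives are
  unique. Positive steps along the coordinate axes stay in the half space, which gives uniqueness
  even at boundary points.\<close>

lemma frechet_derivative_within_half_space:
  fixes f :: "real ^ 'n::finite \<Rightarrow> 'b::real_normed_vector"
  assumes "openin (top_of_set half_space) S" "x \<in> S" and f: "(f has_derivative f') (at x within S)"
  shows "frechet_derivative f (at x within S) = f'"
proof (rule frechet_derivative_unique_within)
  show "(f has_derivative frechet_derivative f (at x within S)) (at x within S)"
    using f by (auto simp: differentiable_def frechet_derivative_works[symmetric])
  show "\<exists>d. 0 < \<bar>d\<bar> \<and> \<bar>d\<bar> < e \<and> x + d *\<^sub>R i \<in> S" if "i \<in> Basis" "e > 0" for i :: "real ^ 'n" and e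
    using that half_space_basis_step[OF assms(1,2)] by (auto simp: Basis_vec_def)
qed (rule f)

text \<open>The line through \<open>x\<close> along a tangential axis stays in the boundary
  hyperplane, and \<open>f\<close> is constant on its part near \<open>x\<close>.\<close>

lemma tangential_derivative_zero:
  fixes f :: "real ^ 'n::finite \<Rightarrow> real"
  assumes S: "openin (top_of_set half_space) S" "x \<in> S" and x: "x $ normal_index = 0"
    and f: "(f has_derivative f') (at x within S)"
    and eq: "\<And>y. y \<in> S \<Longrightarrow> y $ normal_index = 0 \<Longrightarrow> f y = f x"
    and b: "b \<noteq> normal_index"
  shows "f' (axis b 1) = 0"
proof -
  from S obtain \<delta> where \<delta>: "\<delta> > 0" "\<And>y. y \<in> half_space \<Longrightarrow> dist y x < \<delta> \<Longrightarrow> y \<in> S"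
    by (auto simp: openin_euclidean_subtopology_iff)
  let ?l = "\<lambda>s::real. x + s *\<^sub>R axis b 1"
  have norm: "?l s $ normal_index = 0" for s
    using x b by (simp add: axis_def)
  have l: "?l s \<in> S" if "s \<in> ball 0 \<delta>" for s
    using that norm by (intro \<delta>) (auto simp: half_space_def dist_norm norm_axis_1)
  have "(?l has_derivative (\<lambda>s. s *\<^sub>R axis b 1)) (at 0 within ball 0 \<delta>)"
    by (auto intro!: derivative_eq_intros)
  moreover have "(f has_derivative f') (at (?l 0) within ?l ` ball 0 \<delta>)"
    using f l by (auto intro: has_derivative_subset)
  ultimately have "((\<lambda>s. f (?l s)) has_derivative (\<lambda>s. f' (s *\<^sub>R axis b 1))) (at 0 within ball 0 \<delta>)"
    by (rule has_derivative_in_compose)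
  then have "((\<lambda>s. f x) has_derivative (\<lambda>s. f' (s *\<^sub>R axis b 1))) (at 0 within ball 0 \<delta>)"
    by (rule has_derivative_transform[rotated 2]) (use \<delta> l norm eq in auto)
  \<comment> \<open>The line can be followed in both directions, so its derivative at 0 is two-sided
    and hence unique.\<close>
  moreover have "at 0 within ball 0 \<delta> = at (0::real)"
    using \<delta> by (intro at_within_open) auto
  ultimately have "((\<lambda>s. f x) has_derivative (\<lambda>s. f' (s *\<^sub>R axis b 1))) (at (0::real))"
    by simp
  then have "(\<lambda>s::real. f' (s *\<^sub>R axis b 1)) = (\<lambda>_. 0)"
    using has_derivative_const has_derivative_unique by blast
  from fun_cong[OF this, of 1] show ?thesis
    by simp
qed

section \<open>Curve parameters, charts and boundary points\<close>

text \<open>A nondegenerate interval has no isolated points, and neither has a relatively open part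
  of it. Derivatives along the curve are therefore well determined, also at an end point of
  \<open>T\<close>.\<close>

lemma at_within_interval_neq_bot:
  fixes T :: "real set"
  assumes "is_interval T" "interior T \<noteq> {}" "openin (top_of_set T) K" "t \<in> K"
  shows "at t within K \<noteq> bot"
proof -
  obtain V where V: "open V" "K = T \<inter> V"
    using assms(3) openin_open by blast
  have "T \<noteq> {s}" for s
    using assms(2) interior_singleton by metis
  then have "t islimpt T"
    using assms(1,4) V is_interval_connected connected_imp_perfect by blast
  then have "t islimpt T \<inter> V"
    using V assms(4) by (intro islimpt_Int_eventually) (auto simp: eventually_at_topological)
  with V show ?thesis
    by (simp add: trivial_limit_within)
qed

lemma chart_inv_coords:
  assumes "is_chart M c" "p \<in> chart_dom c"
  shows "chart_inv c (coords c p) = p"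
proof -
  have "chart_dom c \<subseteq> topspace M"
    using assms(1) openin_subset by (auto simp: is_chart_def)
  moreover have "inj_on (coords c) (topspace (subtopology M (chart_dom c)))"
    using assms(1) homeomorphic_imp_injective_map unfolding is_chart_def by blast
  ultimately have "inj_on (coords c) (chart_dom c)"
    by (simp add: topspace_subtopology Int_absorb1)
  with assms(2) show ?thesis
    by (simp add: chart_inv_def)
qed

lemma openin_coords_image:
  assumes c: "is_chart M c" and "openin M U" "U \<subseteq> chart_dom c"
  shows "openin (top_of_set half_space) (coords c ` U)"
proof -
  have "openin (subtopology M (chart_dom c)) U"
    using assms(2,3) by (auto simp: openin_subtopology)
  moreover have "open_map (subtopology M (chart_dom c)) (top_of_set (chart_image c)) (coords c)"
    using c homeomorphic_imp_open_map unfolding is_chart_def by blast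
  ultimately have "openin (top_of_set (chart_image c)) (coords c ` U)"
    unfolding open_map_def by blast
  then show ?thesis
    using c openin_trans unfolding is_chart_def by blast
qed

text \<open>At a point interior to one chart but on the boundary of another, the normal coordinate of the
  transition map has a minimum, so the Jacobian has a zero row; the transformation law of a
  nondegenerate metric forbids this.\<close>

lemma boundary_normal_coordinate:
  fixes c :: "('m, 'n::finite) chart"
  assumes M: "manifold_with_boundary M \<A>" and g: "metric_on \<A> (topspace M) g"
    and c: "c \<in> \<A>" "p \<in> chart_dom c" and p: "p \<in> boundary \<A>"
  shows "coords c p $ normal_index = 0"
proof (rule ccontr)
  assume nz: "coords c p $ normal_index \<noteq> 0"
  obtain c' where c': "c' \<in> \<A>" "p \<in> chart_dom c'" "coords c' p $ normal_index = 0"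
    using p by (auto simp: boundary_def)
  have chart: "is_chart M c" "is_chart M c'"
    using M c c' by (auto simp: manifold_with_boundary_def)
  define W where "W = coords c ` (chart_dom c \<inter> chart_dom c')"
  define \<tau> where "\<tau> = transition c c'"
  let ?x = "coords c p"
  have op: "openin M (chart_dom c)" "openin M (chart_dom c')"
    using chart by (auto simp: is_chart_def)
  have W: "openin (top_of_set half_space) W"
    unfolding W_def using op by (intro openin_coords_image[OF chart(1)]) auto
  have xW: "?x \<in> W"
    using c c' by (auto simp: W_def)
  have "?x \<in> half_space"
    using W xW openin_imp_subset by blast
  with nz have pos: "?x $ normal_index > 0"
    by (simp add: half_space_def)
  have \<tau>: "\<tau> (coords c q) = coords c' q" if "q \<in> chart_dom c" for q
    using that by (simp add: \<tau>_def transition_def chart_inv_coords[OF chart(1)])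
  have im: "chart_image c' \<subseteq> half_space"
    using chart openin_imp_subset unfolding is_chart_def by blast
  have \<tau>_nonneg: "0 \<le> \<tau> y $ normal_index" if "y \<in> W" for y
    using that im \<tau> by (auto simp: W_def chart_image_def half_space_def)
  have "smooth_on \<tau> W"
    using M c c' by (auto simp: manifold_with_boundary_def \<tau>_def W_def)
  then obtain \<tau>' where \<tau>': "(\<tau> has_derivative \<tau>') (at ?x within W)"
    using xW smooth_on_has_derivative by blast
  obtain V where V: "open V" "W = half_space \<inter> V"
    using W openin_open by blast
  \<comment> \<open>Near \<open>?x\<close> the half space imposes no constraint, so the derivative
    within \<open>W\<close> becomes a full one, as the minimum criterion requires.\<close>
  define V' where "V' = V \<inter> {y. 0 < y $ normal_index}"
  have V': "open V'" "?x \<in> V'" "V' \<subseteq> W"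
    using V xW pos by (auto simp: V'_def half_space_def intro!: open_Int open_Collect_less continuous_intros)
  have "(\<tau> has_derivative \<tau>') (at ?x)"
    using \<tau>' V' by (metis at_within_open has_derivative_subset)
  then have "((\<lambda>y. \<tau> y $ normal_index) has_derivative (\<lambda>v. \<tau>' v $ normal_index)) (at ?x)"
    by (rule bounded_linear.has_derivative[OF bounded_linear_vec_nth])
  then have "(\<lambda>v. \<tau>' v $ normal_index) = (\<lambda>v. 0)"
    by (rule differential_zero_maxmin[OF V'(2,1)])
      (use \<tau> c c' V' \<tau>_nonneg in auto)
  then have zero: "\<tau>' v $ normal_index = 0" for v
    by meson
  have "jacobian_matrix c c' p = matrix \<tau>'"
    using frechet_derivative_within_half_space[OF W xW \<tau>']
    by (simp add: jacobian_matrix_def W_def \<tau>_def)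
  then have "row normal_index (jacobian_matrix c c' p) = 0"
    by (simp add: row_def matrix_def zero vec_eq_iff)
  then have "det (jacobian_matrix c c' p) = 0"
    by (rule det_zero_row)
  moreover have "p \<in> topspace M"
    using op c openin_subset by blast
  then have "det (g c ?x) \<noteq> 0" "g c ?x =
      transpose (jacobian_matrix c c' p) ** g c' (coords c' p) ** jacobian_matrix c c' p"
    using g c c' unfolding metric_on_def by blast+
  ultimately show False
    by (simp add: det_mul)
qed

section \<open>Tractor components along a curve\<close>

lemma metric_density_pos: "det G \<noteq> 0 \<Longrightarrow> metric_density G > 0"
  by (simp add: metric_density_def)

lemma vector_matrix_mult_scaleR: "(x::real^'n) v* (k *\<^sub>R A) = k *\<^sub>R (x v* A)"
  by (simp add: vector_matrix_mult_def vec_eq_iff sum_distrib_left algebra_simps)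

context
  fixes S :: "(real ^ 'n::finite) set" and G :: "real ^ 'n \<Rightarrow> real ^ 'n ^ 'n"
    and K :: "real set" and x :: "real \<Rightarrow> real ^ 'n"
  assumes K: "\<And>t. t \<in> K \<Longrightarrow> at t within K \<noteq> bot"
begin

lemma fst_velocity_tractor:
  assumes "t \<in> K"
  shows "fst (velocity_tractor S G K x t) = 0"
  using vector_derivative_within[OF K[OF assms] has_vector_derivative_const[of 0]]
  by (simp add: velocity_tractor_def tractor_deriv_along_def density_deriv_along_def tractor_X_def)

text \<open>This is the weighted velocity with its index lowered. Since \<open>tractor_X\<close> has
  only a last slot, just the \<rho> term of the tractor connection contributes.\<close>

lemma covector_velocity_tractor:
  assumes "t \<in> K"
  shows "fst (snd (velocity_tractor S G K x t))
    = inverse (speed_density G K x t) *\<^sub>R (velocity K x t v* conformal_metric (G (x t)))"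
  using vector_derivative_within[OF K[OF assms] has_vector_derivative_const[of 0]]
  by (simp add: velocity_tractor_def tractor_deriv_along_def covector_deriv_along_def tractor_X_def
      Let_def vec_eq_iff)

text \<open>Only the pairing of the velocity with the middle slot of U contributes. The value is the
  speed density up to sign, hence nonzero on a nowhere-null curve.\<close>

lemma fst_acceleration_tractor:
  assumes "t \<in> K"
  shows "fst (acceleration_tractor S G K x t) = - inverse (speed_density G K x t)
    * (velocity K x t \<bullet> (conformal_metric (G (x t)) *v velocity K x t))"
proof -
  \<comment> \<open>The Y component of U is zero on all of \<open>K\<close>, not just at
    \<open>t\<close>, so its derivative vanishes too.\<close>
  have "((\<lambda>t. fst (velocity_tractor S G K x t)) has_vector_derivative 0) (at t within K)"
    by (rule has_vector_derivative_transform[OF assms _ has_vector_derivative_const])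
      (simp add: fst_velocity_tractor)
  then have "vector_derivative (\<lambda>t. fst (velocity_tractor S G K x t)) (at t within K) = 0"
    by (rule vector_derivative_within[OF K[OF assms]])
  then show ?thesis
    by (simp add: acceleration_tractor_def tractor_deriv_along_def density_deriv_along_def
        fst_velocity_tractor covector_velocity_tractor assms Let_def inner_commute
        flip: dot_lmul_matrix)
qed

text \<open>These are the \<open>(Y, Z\<^sub>a, Z\<^sub>b, X)\<close> components of \<open>I \<and> \<Sigma>\<close>.\<close>

lemma nabla_parallel_velocity:
  assumes wedge: "\<And>ix. scale_wedge_three_tractor S G \<sigma> K x t ix = 0" and t: "t \<in> K"
    and \<sigma>: "\<sigma> (x t) = 0" and det: "det (G (x t)) \<noteq> 0"
    and nonnull: "velocity K x t \<bullet> (G (x t) *v velocity K x t) \<noteq> 0"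
  shows "nabla_density S G 1 \<sigma> (x t) $ a * (velocity K x t v* G (x t)) $ b
    = nabla_density S G 1 \<sigma> (x t) $ b * (velocity K x t v* G (x t)) $ a"
proof -
  let ?u = "velocity K x t" and ?s = "speed_density G K x t" and ?d = "metric_density (G (x t))"
  have comp: "tractor_comp V IY = fst V" "tractor_comp V (IZ i) = fst (snd V) $ i"
    "tractor_comp V IX = snd (snd V)" for V :: "'n tractor" and i
    by (cases V; simp)+
  have "?d > 0"
    using det by (rule metric_density_pos)
  have quad: "?u \<bullet> (conformal_metric (G (x t)) *v ?u) \<noteq> 0"
    using nonnull \<open>?d > 0\<close>
    by (simp add: conformal_metric_def scaleR_matrix_vector_assoc[symmetric])
  then have "?s \<noteq> 0"
    by (simp add: speed_density_def)
  \<comment> \<open>The Y components of I, X and U vanish (for I because \<sigma> does at this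
    point), and X has no middle slot.\<close>
  have "6 * inverse ?s * tractor_comp (tractor_X :: 'n tractor) IX * tractor_comp (acceleration_tractor S G K x t) IY
      * (tractor_comp (scale_tractor S G \<sigma> (x t)) (IZ a) * tractor_comp (velocity_tractor S G K x t) (IZ b)
        - tractor_comp (scale_tractor S G \<sigma> (x t)) (IZ b) * tractor_comp (velocity_tractor S G K x t) (IZ a))
    = 0"
  proof (rule alternation_wedge_vanishing)
  qed (use wedge[unfolded scale_wedge_three_tractor_def three_tractor_def] in \<open>simp_all only:\<close>,
      simp_all add: comp scale_tractor_def tractor_X_def \<sigma> fst_velocity_tractor t)
  \<comment> \<open>The prefactors are nonzero, and so is the conformal factor between
    \<open>conformal_metric\<close> and \<open>G\<close>; cancelling them leaves the minor.\<close>
  then show ?thesis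
    using \<open>?s \<noteq> 0\<close> quad \<open>?d > 0\<close>
    by (simp add: comp fst_acceleration_tractor covector_velocity_tractor t tractor_X_def
        scale_tractor_def conformal_metric_def vector_matrix_mult_scaleR)
qed

end

section \<open>Orthogonality at the boundary point\<close>

theorem proposition3:
  fixes M :: "'m topology"
    and \<A> :: "('m, 'n::finite) chart set"
    and g\<^sub>0 g :: "('m, 'n) sym2_field"
    and r :: "'m \<Rightarrow> real"
    and \<gamma> :: "real \<Rightarrow> 'm"
    and T :: "real set"
    and t\<^sub>0 :: real
  assumes "CARD('n) \<ge> 3"
    and "conformally_compact M \<A> g\<^sub>0 g r"
    and "generalised_geodesic M \<A> (conformal_class M \<A> g) (defining_density g r) T \<gamma>"
    and "t\<^sub>0 \<in> T"
    and "\<gamma> t\<^sub>0 \<in> boundary \<A>"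
  shows "orthogonal_to_boundary \<A> (conformal_class M \<A> g) T \<gamma> t\<^sub>0"
  unfolding orthogonal_to_boundary_def
proof (intro ballI impI allI)
  fix h\<^sub>1 c and v :: "real ^ 'n"
  assume h\<^sub>1: "h\<^sub>1 \<in> conformal_class M \<A> g" and c: "c \<in> \<A>" and dom: "\<gamma> t\<^sub>0 \<in> chart_dom c"
    and v: "v $ normal_index = 0"
  have M: "manifold_with_boundary M \<A>" and g: "metric_on \<A> (topspace M) g"
    and r: "defining_function M \<A> r"
    using assms(2) by (auto simp: conformally_compact_def)
  obtain h where h: "h \<in> conformal_class M \<A> g" and nonnull: "nowhere_null \<A> h T \<gamma>"
    and wedge: "\<And>t ix. t \<in> chart_params c T \<gamma> \<Longrightarrow> scale_wedge_three_tractor (chart_image c) (h c)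
      (defining_density g r c) (chart_params c T \<gamma>) (coords c \<circ> \<gamma>) t ix = 0"
    and \<gamma>: "regular_curve M \<A> T \<gamma>"
    using assms(3) c unfolding generalised_geodesic_def by blast
  define p where "p = \<gamma> t\<^sub>0"
  define x where "x = coords c p"
  define S where "S = chart_image c"
  define K where "K = chart_params c T \<gamma>"
  define u where "u = chart_velocity c T \<gamma> t\<^sub>0"
  define \<sigma> where "\<sigma> = defining_density g r c"
  have chart: "is_chart M c"
    using M c by (auto simp: manifold_with_boundary_def)
  have p: "p \<in> chart_dom c" "p \<in> boundary \<A>" "p \<in> topspace M"
    using dom assms(5) chart openin_subset by (auto simp: p_def is_chart_def)
  have t: "t\<^sub>0 \<in> K"
    using assms(4) dom by (simp add: K_def chart_params_def)
  have S: "openin (top_of_set half_space) S" and xS: "x \<in> S"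
    using chart p by (auto simp: S_def x_def is_chart_def chart_image_def)
  have "openin (top_of_set T) K"
    using openin_continuous_map_preimage[of "top_of_set T" M \<gamma> "chart_dom c"] \<gamma> chart
    by (simp add: K_def chart_params_def regular_curve_def is_chart_def)
  then have K: "at t within K \<noteq> bot" if "t \<in> K" for t
    using \<gamma> that at_within_interval_neq_bot unfolding regular_curve_def by blast
  \<comment> \<open>Membership in \<open>boundary\<close> concerns some chart of the atlas, whereas
    the tangent space here is read off in \<open>c\<close>.\<close>
  have x0: "x $ normal_index = 0"
    unfolding x_def using M g c p(1,2) by (rule boundary_normal_coordinate)
  have r0: "r (chart_inv c y) = 0" if "y \<in> S" "y $ normal_index = 0" for y
  proof -
    obtain q where q: "q \<in> chart_dom c" "y = coords c q"
      using \<open>y \<in> S\<close> by (auto simp: S_def chart_image_def)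
    then have "q \<in> boundary \<A>"
      using c that by (auto simp: boundary_def)
    then have "r q = 0"
      using r by (auto simp: defining_function_def)
    then show ?thesis
      using q chart by (simp add: chart_inv_coords)
  qed
  have sub: "chart_dom c \<inter> topspace M = chart_dom c"
    using chart openin_subset by (auto simp: is_chart_def)

  have "smooth_on (r \<circ> chart_inv c) S"
    using r c by (auto simp: defining_function_def smooth_function_def S_def)
  then obtain r' where r': "((r \<circ> chart_inv c) has_derivative r') (at x within S)"
    using xS smooth_on_has_derivative by blast
  \<comment> \<open>\<open>r\<close> is constant on the boundary face of the chart, so dr, being
    nonzero, has exactly a normal component.\<close>
  have r'_tang: "r' (axis b 1) = 0" if "b \<noteq> normal_index" for b
    using tangential_derivative_zero[OF S xS x0 r' _ that] r0 xS x0 by simp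
  have "\<exists>i. r' (axis i 1) \<noteq> 0"
    using r c p frechet_derivative_within_half_space[OF S xS r']
    by (auto simp: defining_function_def partial_deriv_def S_def x_def)
  with r'_tang have r'_normal: "r' (axis normal_index 1) \<noteq> 0"
    by metis

  have "smooth_on (g c) S"
    using g c sub unfolding metric_on_def S_def chart_image_def by metis
  then have "continuous_on S (g c)"
    by (rule smooth_on_imp_continuous_on)
  moreover have det_g: "det (g c y) \<noteq> 0" if "y \<in> S" for y
    using that g c sub unfolding metric_on_def S_def chart_image_def by blast
  moreover from calculation have "continuous_on S (\<lambda>y. det (g c y))"
    unfolding det_def by (intro continuous_intros)
  ultimately have "continuous_on S (\<lambda>y. metric_density (g c y))"
    unfolding metric_density_def by (auto intro!: continuous_intros)
  then have "continuous (at x within S) (\<lambda>y. metric_density (g c y))"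
    using xS by (simp add: continuous_on_eq_continuous_within)
  from has_derivative_mult_vanishing[OF r' _ this]
  have "(\<sigma> has_derivative (\<lambda>v. r' v * metric_density (g c x))) (at x within S)"
    using r0 xS x0 by (simp add: \<sigma>_def defining_density_def)
  moreover have \<sigma>0: "\<sigma> x = 0"
    using r0 xS x0 by (simp add: \<sigma>_def defining_density_def)
  \<comment> \<open>The connection term carries the factor \<open>\<sigma> x = 0\<close>, so the
    covariant derivative at \<open>x\<close> is sigma_g dr even though the scale \<open>h\<close>
    may differ from \<open>g\<close>.\<close>
  ultimately have nabla: "nabla_density S (h c) 1 \<sigma> x $ i = r' (axis i 1) * metric_density (g c x)" for i
    by (simp add: frechet_derivative_within_half_space[OF S xS] nabla_density_def partial_deriv_def)

  \<comment> \<open>The scale \<open>h\<close> of the geodesic condition and the metric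
    \<open>h\<^sub>1\<close> testing orthogonality may differ; both are positive multiples of
    \<open>g\<close> at \<open>x\<close>, so orthogonality passes between them.\<close>
  obtain \<omega> where \<omega>: "h c x = exp (2 * \<omega>) *\<^sub>R g c x"
    using h c p by (auto simp: conformal_class_def x_def)
  obtain \<omega>\<^sub>1 where \<omega>\<^sub>1: "h\<^sub>1 c x = exp (2 * \<omega>\<^sub>1) *\<^sub>R g c x"
    using h\<^sub>1 c p by (auto simp: conformal_class_def x_def)
  have "nabla_density S (h c) 1 \<sigma> ((coords c \<circ> \<gamma>) t\<^sub>0) $ a
        * (velocity K (coords c \<circ> \<gamma>) t\<^sub>0 v* h c ((coords c \<circ> \<gamma>) t\<^sub>0)) $ b
      = nabla_density S (h c) 1 \<sigma> ((coords c \<circ> \<gamma>) t\<^sub>0) $ b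
        * (velocity K (coords c \<circ> \<gamma>) t\<^sub>0 v* h c ((coords c \<circ> \<gamma>) t\<^sub>0)) $ a" for a b
  proof (rule nabla_parallel_velocity[OF K])
    show "scale_wedge_three_tractor S (h c) \<sigma> K (coords c \<circ> \<gamma>) t\<^sub>0 ix = 0" for ix
      using wedge t by (simp add: S_def K_def \<sigma>_def)
    show "det (h c ((coords c \<circ> \<gamma>) t\<^sub>0)) \<noteq> 0"
      using \<omega> det_g xS by (simp add: x_def p_def det_scaleR)
    show "velocity K (coords c \<circ> \<gamma>) t\<^sub>0 \<bullet> (h c ((coords c \<circ> \<gamma>) t\<^sub>0) *v velocity K (coords c \<circ> \<gamma>) t\<^sub>0) \<noteq> 0"
      using nonnull c t by (simp add: nowhere_null_def chart_velocity_def K_def)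
  qed (use t \<sigma>0 in \<open>simp_all add: x_def p_def\<close>)
  then have parallel: "nabla_density S (h c) 1 \<sigma> x $ a * (u v* h c x) $ b
      = nabla_density S (h c) 1 \<sigma> x $ b * (u v* h c x) $ a" for a b
    by (simp add: x_def p_def u_def K_def chart_velocity_def)
  \<comment> \<open>Pairing \<open>b\<close> with the normal index makes one side vanish by
    \<open>r'_tang\<close>, while the other has a nonzero factor from \<open>r'_normal\<close>. The
    lowered velocity is thus conormal to the boundary.\<close>
  have "(u v* h c x) $ b = 0" if "b \<noteq> normal_index" for b
    using parallel[of normal_index b] r'_tang[OF that] r'_normal metric_density_pos[OF det_g[OF xS]]
    by (simp add: nabla)
  then have "(u v* g c x) $ b = 0" if "b \<noteq> normal_index" for b
    using that by (simp add: \<omega> vector_matrix_mult_scaleR)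
  then have "(u v* g c x) $ b * v $ b = 0" for b
    using v by (cases "b = normal_index") auto
  then have "(u v* g c x) \<bullet> v = 0"
    by (simp only: inner_vec_def inner_real_def sum.neutral_const)
  then have "u \<bullet> (h\<^sub>1 c x *v v) = 0"
    by (simp add: \<omega>\<^sub>1 vector_matrix_mult_scaleR flip: dot_lmul_matrix)
  then show "chart_velocity c T \<gamma> t\<^sub>0 \<bullet> (h\<^sub>1 c (coords c (\<gamma> t\<^sub>0)) *v v) = 0"
    by (simp add: u_def x_def p_def)
qed

end
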